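(* Let $V$ be a digraph on $\mathcal N=\{1,\dots,N\}$ with real arc weights, let $2\le k\le N-1$ with $\mathcal F^{k}(V)\neq\emptyset$, and suppose $\varphi_{k-1}-\varphi_k>\varphi_k-\varphi_{k+1}$ (this being considered satisfied when $\varphi_{k-1}=+\infty$). Then the algebra $\aleph_k$ contains exactly $k$ marked elementary sets.
   Context: $V$ is a directed graph with vertex set $\mathcal N$, arc set $\mathcal A V\subseteq\mathcal N^2$, and real weights $v_{ij}$ on arcs $(i,j)$. A forest is a digraph without directed circuits (loops count as circuits) in which every vertex has outdegree $0$ or $1$; its trees are its weakly connected components; the root of a tree is its unique vertex of outdegree $0$. $\mathcal F^k(V)$ is the set of spanning subgraphs of $V$ that are forests with exactly $k$ trees; $\Sigma^F=\sum_{(i,j)\in\mathcal A F}v_{ij}$; $\varphi_k=\min_{F\in\mathcal F^k(V)}\Sigma^F$ ($+\infty$ if empty); $\tilde{\mathcal F}^k(V)=\{F\in\mathcal F^k(V):\Sigma^F=\varphi_k\}$. $\aleph_k$ is the algebra of subsets of $\mathcal N$ generated by the vertex sets of all trees of all forests in $\tilde{\mathcal F}^k(V)$; its elementary sets are its minimal nonempty members. A vertex $j$ is a marked vertex of level $k$ if $j$ is a root of some forest $F\in\tilde{\mathcal F}^k(V)$; an elementary set of $\aleph_k$ is marked if it contains a marked vertex of level $k$. *)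

theory Defs
  imports "HOL-Analysis.Sigma_Algebra" "HOL-Library.Extended_Real" "Graph_Theory.Graph_Theory"
begin

text \<open>Loops are cycles in the sense of \<^const>\<open>pre_digraph.cycle\<close>, so \<^const>\<open>forest\<close>
  excludes them; it forbids directed cycles only.\<close>

definition diforest :: "('a, 'b) pre_digraph \<Rightarrow> bool" where
  "diforest G \<longleftrightarrow> fin_digraph G \<and> forest G \<and> (\<forall>x\<in>verts G. out_degree G x \<le> 1)"

text \<open>\<^const>\<open>Digraph_Component.connected\<close> refers to the underlying symmetric graph and
  requires a nonempty vertex set, so these are the weakly connected components.\<close>

definition trees :: "('a, 'b) pre_digraph \<Rightarrow> ('a, 'b) pre_digraph set" where
  "trees G = {T. pre_digraph.max_subgraph G Digraph_Component.connected T}"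

definition is_root :: "('a, 'b) pre_digraph \<Rightarrow> 'a \<Rightarrow> bool" where
  "is_root T r \<longleftrightarrow> r \<in> verts T \<and> out_degree T r = 0"

definition spanning_forests :: "'a pair_pre_digraph \<Rightarrow> nat \<Rightarrow> 'a pair_pre_digraph set" where
  "spanning_forests V k =
     {F. spanning (with_proj F) (with_proj V) \<and> diforest (with_proj F) \<and>
         card (trees (with_proj F)) = k}"

definition weight :: "('a \<times> 'a \<Rightarrow> real) \<Rightarrow> 'a pair_pre_digraph \<Rightarrow> real" where
  "weight v F = (\<Sum>a\<in>parcs F. v a)"

text \<open>Extended reals: \<open>\<infinity> - a > b\<close> holds for all finite \<open>a\<close>, \<open>b\<close>, so a gap condition whose
  larger term is infinite is satisfied automatically.\<close>

definition min_weight :: "'a pair_pre_digraph \<Rightarrow> ('a \<times> 'a \<Rightarrow> real) \<Rightarrow> nat \<Rightarrow> ereal" where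
  "min_weight V v k =
     (if spanning_forests V k = {} then \<infinity> else ereal (Min (weight v ` spanning_forests V k)))"

definition min_forests ::
    "'a pair_pre_digraph \<Rightarrow> ('a \<times> 'a \<Rightarrow> real) \<Rightarrow> nat \<Rightarrow> 'a pair_pre_digraph set" where
  "min_forests V v k = {F \<in> spanning_forests V k. ereal (weight v F) = min_weight V v k}"

definition generated_algebra :: "'a set \<Rightarrow> 'a set set \<Rightarrow> 'a set set" where
  "generated_algebra \<Omega> S = \<Inter>{M. algebra \<Omega> M \<and> S \<subseteq> M}"

definition forest_algebra ::
    "'a pair_pre_digraph \<Rightarrow> ('a \<times> 'a \<Rightarrow> real) \<Rightarrow> nat \<Rightarrow> 'a set set" where
  "forest_algebra V v k =
     generated_algebra (pverts V)
       {verts T | T F. F \<in> min_forests V v k \<and> T \<in> trees (with_proj F)}"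

definition elementary_sets :: "'a set set \<Rightarrow> 'a set set" where
  "elementary_sets M = {A \<in> M. A \<noteq> {} \<and> (\<forall>B\<in>M. B \<noteq> {} \<and> B \<subseteq> A \<longrightarrow> B = A)}"

definition marked_vertex ::
    "'a pair_pre_digraph \<Rightarrow> ('a \<times> 'a \<Rightarrow> real) \<Rightarrow> nat \<Rightarrow> 'a \<Rightarrow> bool" where
  "marked_vertex V v k j \<longleftrightarrow>
     (\<exists>F\<in>min_forests V v k. \<exists>T\<in>trees (with_proj F). is_root T j)"

definition marked_elementary_sets ::
    "'a pair_pre_digraph \<Rightarrow> ('a \<times> 'a \<Rightarrow> real) \<Rightarrow> nat \<Rightarrow> 'a set set" where
  "marked_elementary_sets V v k =
     {A \<in> elementary_sets (forest_algebra V v k). \<exists>j\<in>A. marked_vertex V v k j}"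

end

theory Submission
  imports Defs
begin

text \<open>Let \<open>F\<close>, \<open>G\<close> be minimal forests with \<open>k\<close> trees and \<open>D\<close> the vertex set of a tree of \<open>F\<close>.
  Exchanging the arcs of \<open>F\<close> and \<open>G\<close> that start in \<open>D\<close> yields two forests of the same total
  weight, with \<open>k - 1 + m\<close> and \<open>k + 1 - m\<close> trees, where \<open>m\<close> is the number of roots of \<open>G\<close> in
  \<open>D\<close>. The gap condition excludes \<open>m = 0\<close>; as the \<open>k\<close> roots of \<open>G\<close> are distributed over the \<open>k\<close>
  trees of \<open>F\<close>, always \<open>m = 1\<close>, and both new forests are minimal. So the root of \<open>F\<close> in \<open>D\<close> may be
  replaced by that of \<open>G\<close>, which forces the two into the same tree of every minimal forest.
  Hence each tree of \<open>F\<close> meets exactly one marked elementary set.\<close>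

subsection \<open>Forests as acyclic single-valued relations\<close>

locale in_forest = pair_fin_digraph F for F :: "'a pair_pre_digraph" +
  assumes single_valued: "single_valued (parcs F)"
    and acyclic: "acyclic (parcs F)"

definition roots :: "'a pair_pre_digraph \<Rightarrow> 'a set" where
  "roots F = pverts F - Domain (parcs F)"

text \<open>For a root \<open>r\<close> of a forest this is the vertex set of the tree rooted at
  \<open>r\<close>: the maximal path from each of its vertices ends at \<open>r\<close>.\<close>

definition basin :: "'a pair_pre_digraph \<Rightarrow> 'a \<Rightarrow> 'a set" where
  "basin F r = {x \<in> pverts F. (x, r) \<in> (parcs F)\<^sup>*}"

text \<open>A closed walk of positive length contains a cycle, and such walks are what the
  transitive closure of the arc relation records.\<close>

lemma (in fin_digraph) forest_iff_acyclic: "forest G \<longleftrightarrow> acyclic (arcs_ends G)"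
proof
  assume f: "forest G"
  show "acyclic (arcs_ends G)"
  proof (rule acyclicI, rule allI, rule notI)
    fix x assume "x \<rightarrow>\<^sup>+ x"
    then obtain p where "awalk x p x" "p \<noteq> []" by (auto simp: reachable1_awalk)
    then have "closed_w p" by (auto simp: closed_w_def)
    then show False using f closed_w_imp_cycle by (auto simp: forest_def)
  qed
next
  assume a: "acyclic (arcs_ends G)"
  show "forest G"
    unfolding forest_def
  proof
    assume "\<exists>p. cycle p"
    then obtain u p where "awalk u p u" "p \<noteq> []" by (auto simp: cycle_def)
    then have "u \<rightarrow>\<^sup>+ u" using reachable1_awalk by blast
    then show False using a by (simp add: acyclic_def)
  qed
qed

lemma fin_digraph_with_proj_iff: "fin_digraph (with_proj F) \<longleftrightarrow> pair_fin_digraph F"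
proof
  assume "fin_digraph (with_proj F)"
  then interpret fin_digraph "with_proj F" .
  show "pair_fin_digraph F"
    using wellformed finite_verts finite_arcs by unfold_locales auto
next
  assume "pair_fin_digraph F"
  then interpret pair_fin_digraph F .
  show "fin_digraph (with_proj F)" by unfold_locales
qed

lemma diforest_iff_in_forest: "diforest (with_proj F) \<longleftrightarrow> in_forest F"
proof (cases "pair_fin_digraph F")
  case True
  then interpret pair_fin_digraph F .
  have "(\<forall>x\<in>pverts F. out_degree (with_proj F) x \<le> 1) \<longleftrightarrow> single_valued (parcs F)"
  proof -
    have "finite (out_arcs (with_proj F) x)" for x by (rule finite_out_arcs)
    then have "out_degree (with_proj F) x \<le> 1 \<longleftrightarrow> (\<forall>y z. (x, y) \<in> parcs F \<longrightarrow> (x, z) \<in> parcs F \<longrightarrow> y = z)" for x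
      by (fastforce simp: out_degree_def out_arcs_def card_le_Suc0_iff_eq)
    then show ?thesis unfolding single_valued_def using wellformed'(1) by blast
  qed
  moreover have "forest (with_proj F) \<longleftrightarrow> acyclic (parcs F)"
    using forest_iff_acyclic by simp
  ultimately show ?thesis
    using True by (simp add: diforest_def fin_digraph_with_proj_iff in_forest_def in_forest_axioms_def) blast
next
  case False
  then show ?thesis
    by (simp add: diforest_def fin_digraph_with_proj_iff in_forest_def)
qed

section \<open>Trees of a forest as basins of its roots\<close>

context in_forest
begin

lemma finite_roots: "finite (roots F)"
  using pair_finite_verts by (simp add: roots_def)

lemma root_in_basin: "r \<in> roots F \<Longrightarrow> r \<in> basin F r"
  by (simp add: roots_def basin_def)

text \<open>The arc \<open>(x, y)\<close> is the only one leaving \<open>x\<close>, so every path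
  from \<open>x\<close> to a root passes through \<open>y\<close>. Hence no arc crosses the boundary
  of the basin of a root.\<close>

lemma basin_arc_iff:
  assumes "r \<in> roots F" "(x, y) \<in> parcs F"
  shows "x \<in> basin F r \<longleftrightarrow> y \<in> basin F r"
proof
  assume "x \<in> basin F r"
  then have "(x, r) \<in> (parcs F)\<^sup>*" by (simp add: basin_def)
  then have "(y, r) \<in> (parcs F)\<^sup>*"
  proof (cases rule: converse_rtranclE)
    case base
    then show ?thesis using assms by (auto simp: roots_def)
  next
    case (step z)
    then show ?thesis using single_valuedD[OF single_valued assms(2) step(1)] by simp
  qed
  then show "y \<in> basin F r" using wellformed'(2)[OF assms(2)] by (simp add: basin_def)
next
  assume "y \<in> basin F r"
  then show "x \<in> basin F r"
    using wellformed'(1)[OF assms(2)] converse_rtrancl_into_rtrancl[OF assms(2)] by (simp add: basin_def)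
qed

lemma roots_Int_basin: "r \<in> roots F \<Longrightarrow> roots F \<inter> basin F r = {r}"
  by (auto simp: roots_def basin_def elim: converse_rtranclE)

text \<open>Membership in the basin of \<open>s\<close> passes along the path from \<open>x\<close>
  to \<open>r\<close>, so \<open>r\<close> is a root in that basin; the only such root is
  \<open>s\<close>.\<close>

lemma basin_disjoint:
  assumes "r \<in> roots F" "s \<in> roots F" "x \<in> basin F r" "x \<in> basin F s"
  shows "r = s"
proof -
  have "(x, r) \<in> (parcs F)\<^sup>*" using assms by (simp add: basin_def)
  then have "x \<in> basin F s \<longrightarrow> r \<in> basin F s"
    by (induction rule: rtrancl_induct) (use basin_arc_iff[OF assms(2)] in blast)+
  then show ?thesis using assms roots_Int_basin[of s] by auto
qed

text \<open>Following arcs must end at a root, because the converse of a finite acyclic relation is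
  well-founded.\<close>

lemma basin_exists:
  assumes "x \<in> pverts F"
  obtains r where "r \<in> roots F" "x \<in> basin F r"
proof -
  have "wf ((parcs F)\<inverse>)"
    using pair_finite_arcs acyclic by (simp add: finite_acyclic_wf_converse)
  then have "x \<in> pverts F \<longrightarrow> (\<exists>r\<in>roots F. x \<in> basin F r)"
  proof (induction x rule: wf_induct_rule)
    case (less x)
    show ?case
    proof (cases "x \<in> Domain (parcs F)")
      case True
      then obtain y where y: "(x, y) \<in> parcs F" by auto
      then have "y \<in> pverts F" by (rule wellformed'(2))
      then obtain r where "r \<in> roots F" "y \<in> basin F r"
        using less y by blast
      then show ?thesis using basin_arc_iff y by blast
    next
      case False
      then show ?thesis using root_in_basin by (auto simp: roots_def)
    qed
  qed
  then show ?thesis using assms that by blast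
qed

lemma connected_subgraph_in_basin:
  assumes "r \<in> roots F" "subgraph H (with_proj F)" "Digraph_Component.connected H"
    and "x \<in> verts H" "x \<in> basin F r"
  shows "verts H \<subseteq> basin F r"
proof
  fix y assume "y \<in> verts H"
  then have "(x, y) \<in> rtrancl_on (verts H) ((arcs_ends H)\<^sup>s)"
    using assms by (auto simp: connected_conv)
  moreover have "arcs_ends H \<subseteq> parcs F"
    using arcs_ends_mono[OF assms(2)] by simp
  ultimately show "y \<in> basin F r"
  proof (induction rule: rtrancl_on_induct)
    case base
    show ?case by (rule assms(5))
  next
    case (step y z)
    then have "(y, z) \<in> parcs F \<or> (z, y) \<in> parcs F" by (auto simp: symcl_def)
    then show ?case using step basin_arc_iff[OF assms(1)] by blast
  qed
qed

text \<open>Every vertex has a directed path to \<open>r\<close> inside the basin, so in the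
  symmetric closure any two vertices are joined through \<open>r\<close>.\<close>

lemma connected_basin:
  assumes "r \<in> roots F"
  shows "Digraph_Component.connected (with_proj F \<restriction> basin F r)" (is "Digraph_Component.connected ?T")
proof (rule wf_digraph.connectedI)
  show "wf_digraph ?T" by (rule wellformed_induce_subgraph)
  interpret T: wf_digraph ?T by fact
  interpret S: pair_wf_digraph "mk_symmetric ?T" by (rule T.wellformed_mk_symmetric)
  show "verts ?T \<noteq> {}" using root_in_basin[OF assms] by auto
  have to_root: "x \<rightarrow>\<^sup>*\<^bsub>with_proj (mk_symmetric ?T)\<^esub> r" if "x \<in> basin F r" for x
  proof -
    have "(x, r) \<in> (parcs F)\<^sup>*" using that by (simp add: basin_def)
    then show ?thesis
    proof (induction rule: converse_rtrancl_induct)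
      case base
      show ?case by (rule S.reachable_refl) (simp add: root_in_basin[OF assms])
    next
      case (step y z)
      have "z \<in> basin F r" using step wellformed' by (auto simp: basin_def)
      then have "(y, z) \<in> parcs (mk_symmetric ?T)"
        using step(1) basin_arc_iff[OF assms step(1)] by (simp add: parcs_mk_symmetric) metis
      then show ?case using step S.adj_reachable_trans by simp
    qed
  qed
  fix x y assume "x \<in> verts ?T" "y \<in> verts ?T"
  then have "x \<rightarrow>\<^sup>*\<^bsub>with_proj (mk_symmetric ?T)\<^esub> r" "r \<rightarrow>\<^sup>*\<^bsub>with_proj (mk_symmetric ?T)\<^esub> y"
    using to_root by (auto intro: symmetric_reachable[OF symmetric_mk_symmetric])
  then show "x \<rightarrow>\<^sup>*\<^bsub>with_proj (mk_symmetric ?T)\<^esub> y" by (rule S.reachable_trans)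
qed

lemma subgraph_basin: "subgraph (with_proj F \<restriction> basin F r) (with_proj F)"
  by (rule subgraph_induce_subgraphI) (auto simp: basin_def)

text \<open>A connected subgraph stays within one basin, since no arc crosses its boundary, and each
  basin induces a connected subgraph. So these induced subgraphs are the maximal connected
  ones.\<close>

lemma trees_eq: "trees (with_proj F) = (\<lambda>r. with_proj F \<restriction> basin F r) ` roots F"
proof (intro equalityI subsetI)
  fix T assume "T \<in> trees (with_proj F)"
  then have T: "max_subgraph Digraph_Component.connected T" by (simp add: trees_def)
  then have sub: "subgraph T (with_proj F)" and conn: "Digraph_Component.connected T"
    by (auto simp: max_subgraph_def)
  then obtain x where x: "x \<in> verts T" by (auto simp: connected_conv)
  then have "x \<in> pverts F" using subgraph_imp_subverts[OF sub] by auto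
  then obtain r where r: "r \<in> roots F" "x \<in> basin F r" by (rule basin_exists)
  have "verts T \<subseteq> basin F r"
    using connected_subgraph_in_basin[OF r(1) sub conn x r(2)] .
  moreover have "wf_digraph (with_proj F \<restriction> basin F r)" by (rule wellformed_induce_subgraph)
  ultimately have "subgraph T (with_proj F \<restriction> basin F r)"
    using sub by (force simp: subgraph_def compatible_def wf_digraph_def)
  then have "T = with_proj F \<restriction> basin F r"
    using T connected_basin[OF r(1)] subgraph_basin[of r] unfolding max_subgraph_def by metis
  then show "T \<in> (\<lambda>r. with_proj F \<restriction> basin F r) ` roots F" using r by blast
next
  fix T assume "T \<in> (\<lambda>r. with_proj F \<restriction> basin F r) ` roots F"
  then obtain r where r: "r \<in> roots F" and T: "T = with_proj F \<restriction> basin F r" by auto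
  have "max_subgraph Digraph_Component.connected T"
  proof (rule max_subgraphI)
    show "Digraph_Component.connected T" "subgraph T (with_proj F)"
      using connected_basin[OF r] subgraph_basin by (auto simp: T)
    fix H assume H: "T \<noteq> H" "subgraph T H" "subgraph H (with_proj F)"
    show "\<not> Digraph_Component.connected H"
    proof
      assume c: "Digraph_Component.connected H"
      have "r \<in> verts H" using subgraph_imp_subverts[OF H(2)] root_in_basin[OF r] by (auto simp: T)
      then have "verts H \<subseteq> basin F r"
        using connected_subgraph_in_basin[OF r H(3) c] root_in_basin[OF r] by blast
      then have "subgraph H T"
        using H(2,3) by (force simp: T subgraph_def compatible_def wf_digraph_def)
      then have "verts T = verts H" "arcs T = arcs H" "tail T = tail H" "head T = head H"
        using H(2) by (auto simp: subgraph_def compatible_def)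
      then show False using H(1) by simp
    qed
  qed
  then show "T \<in> trees (with_proj F)" by (simp add: trees_def)
qed

lemma verts_trees: "verts ` trees (with_proj F) = basin F ` roots F"
  by (simp add: trees_eq image_image)

lemma inj_on_basin: "inj_on (basin F) (roots F)"
  using root_in_basin basin_disjoint by (metis inj_onI)

lemma card_trees: "card (trees (with_proj F)) = card (roots F)"
proof -
  have "inj_on (\<lambda>r. with_proj F \<restriction> basin F r) (roots F)"
    using inj_on_basin by (metis (mono_tags, lifting) induce_subgraph_verts inj_on_def)
  then show ?thesis by (simp add: trees_eq card_image)
qed

lemma is_root_tree_iff: "(\<exists>T\<in>trees (with_proj F). is_root T j) \<longleftrightarrow> j \<in> roots F"
proof -
  have "is_root (with_proj F \<restriction> basin F r) j \<longleftrightarrow> j = r" if r: "r \<in> roots F" for r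
  proof -
    \<comment> \<open>The out-degree is a cardinality, and \<open>card\<close> returns 0 on infinite
      sets too; finiteness makes degree 0 mean that no arc leaves \<open>j\<close>.\<close>
    have "finite (out_arcs (with_proj F \<restriction> basin F r) j)"
      by (rule finite_subset[OF _ pair_finite_arcs]) (auto simp: out_arcs_def)
    then have "is_root (with_proj F \<restriction> basin F r) j \<longleftrightarrow> j \<in> basin F r \<and> j \<notin> Domain (parcs F)"
      using basin_arc_iff[OF r] by (auto simp: is_root_def out_degree_def out_arcs_def)
    also have "\<dots> \<longleftrightarrow> j \<in> roots F \<inter> basin F r" by (auto simp: roots_def basin_def)
    finally show ?thesis using roots_Int_basin[OF r] by simp
  qed
  then show ?thesis by (auto simp: trees_eq)
qed

end

section \<open>Spanning forests and their minimal weight\<close>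

lemma in_spanning_forests_iff:
  assumes "pair_fin_digraph V"
  shows "F \<in> spanning_forests V k \<longleftrightarrow>
    pverts F = pverts V \<and> parcs F \<subseteq> parcs V \<and> in_forest F \<and> card (roots F) = k"
proof -
  interpret V: pair_fin_digraph V by fact
  have "in_forest F \<Longrightarrow> wf_digraph (with_proj F)"
    by (simp add: in_forest_def pair_fin_digraph_def wf_digraph_wp_iff)
  then show ?thesis
    unfolding spanning_forests_def spanning_def subgraph_def
    using V.wf_digraph by (auto simp: diforest_iff_in_forest in_forest.card_trees)
qed

lemma finite_spanning_forests:
  assumes "pair_fin_digraph V"
  shows "finite (spanning_forests V k)"
proof -
  interpret V: pair_fin_digraph V by fact
  have "spanning_forests V k \<subseteq> (\<lambda>R. \<lparr>pverts = pverts V, parcs = R\<rparr>) ` Pow (parcs V)"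
  proof
    fix F assume "F \<in> spanning_forests V k"
    then have "F = \<lparr>pverts = pverts V, parcs = parcs F\<rparr>" "parcs F \<in> Pow (parcs V)"
      by (auto simp: in_spanning_forests_iff[OF assms])
    then show "F \<in> (\<lambda>R. \<lparr>pverts = pverts V, parcs = R\<rparr>) ` Pow (parcs V)" by (rule image_eqI)
  qed
  then show ?thesis using V.pair_finite_arcs by (meson finite_Pow_iff finite_imageI finite_subset)
qed

lemma min_weight_eq: "F \<in> min_forests V v k \<Longrightarrow> min_weight V v k = ereal (weight v F)"
  by (simp add: min_forests_def)

lemma min_weight_le:
  assumes "pair_fin_digraph V" "F \<in> spanning_forests V k"
  shows "min_weight V v k \<le> ereal (weight v F)"
  using assms finite_spanning_forests[OF assms(1), of k] by (auto simp: min_weight_def)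

lemma min_forests_nonempty:
  assumes "pair_fin_digraph V" "spanning_forests V k \<noteq> {}"
  shows "min_forests V v k \<noteq> {}"
proof -
  have "Min (weight v ` spanning_forests V k) \<in> weight v ` spanning_forests V k"
    using assms finite_spanning_forests[OF assms(1), of k] by (intro Min_in) auto
  then show ?thesis using assms(2) by (auto simp: min_forests_def min_weight_def)
qed

subsection \<open>Exchanging arcs\<close>

text \<open>Arcs are selected by their starting vertex, so out-degrees stay at most 1 if they are so
  in \<open>F\<close> and \<open>G\<close>. The set \<open>- D\<close> gives the complementary
  exchange.\<close>

definition exchange :: "'a set \<Rightarrow> 'a pair_pre_digraph \<Rightarrow> 'a pair_pre_digraph \<Rightarrow> 'a pair_pre_digraph" where
  "exchange D G F =
     \<lparr>pverts = pverts F, parcs = {a \<in> parcs G. fst a \<in> D} \<union> {a \<in> parcs F. fst a \<notin> D}\<rparr>"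

text \<open>By \<open>closed\<close>, no arc of \<open>F\<close> enters \<open>D\<close> from
  outside, so a path that has left \<open>D\<close> never returns. A circuit would lie outside
  \<open>D\<close>, as a circuit of \<open>F\<close>, or inside, as one of \<open>G\<close>.\<close>

lemma in_forest_exchange:
  assumes "in_forest F" "in_forest G" "pverts F = pverts G"
    and closed: "\<And>x y. (x, y) \<in> parcs F \<Longrightarrow> x \<notin> D \<Longrightarrow> y \<notin> D"
  shows "in_forest (exchange D G F)"
proof -
  interpret F: in_forest F by fact
  interpret G: in_forest G by fact
  let ?Z = "parcs (exchange D G F)"
  have Z_out: "y \<notin> D \<and> (x, y) \<in> (parcs F)\<^sup>+" if "(x, y) \<in> ?Z\<^sup>+" "x \<notin> D" for x y
    using that
    by (induction rule: trancl_induct)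
       (auto simp: exchange_def dest: closed intro: trancl_into_trancl)
  have Z_in: "(x, y) \<in> (parcs G)\<^sup>+" if "(x, y) \<in> ?Z\<^sup>+" "y \<in> D" for x y
    using that
  proof (induction rule: converse_trancl_induct)
    case (base x)
    then show ?case using closed by (auto simp: exchange_def)
  next
    case (step x z)
    then have "z \<in> D" using Z_out by blast
    then have "(x, z) \<in> parcs G" using step closed by (auto simp: exchange_def)
    then show ?case using step by (auto intro: trancl_into_trancl2)
  qed
  show ?thesis
  proof
    show "acyclic ?Z"
      using Z_in Z_out F.acyclic G.acyclic by (metis acyclic_def)
    show "single_valued ?Z"
      using F.single_valued G.single_valued by (auto simp: exchange_def single_valued_def)
    show "finite ?Z" using F.pair_finite_arcs G.pair_finite_arcs by (simp add: exchange_def)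
  qed (use F.pair_finite_verts F.wellformed' G.wellformed' assms(3) in \<open>auto simp: exchange_def\<close>)
qed

lemma roots_exchange:
  assumes "pverts F = pverts G"
  shows "roots (exchange D G F) = (roots G \<inter> D) \<union> (roots F - D)"
proof -
  have "Domain (parcs (exchange D G F)) = Domain (parcs G) \<inter> D \<union> (Domain (parcs F) - D)"
    by (auto simp: exchange_def)
  moreover have "pverts (exchange D G F) = pverts F" by (simp add: exchange_def)
  ultimately show ?thesis using assms unfolding roots_def by auto
qed

text \<open>Each arc of \<open>F\<close> and each arc of \<open>G\<close> goes into exactly one of
  the two exchanges; an arc common to both forests occurs in both.\<close>

lemma weight_exchange:
  assumes "finite (parcs F)" "finite (parcs G)"
  shows "weight v (exchange D G F) + weight v (exchange (- D) G F) = weight v F + weight v G"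
proof -
  have split: "sum v A = sum v {a \<in> A. fst a \<in> D} + sum v {a \<in> A. fst a \<notin> D}" if "finite A" for A
    using that by (subst sum.union_disjoint[symmetric]) (auto intro: sum.cong)
  have "weight v (exchange E G F) = sum v {a \<in> parcs G. fst a \<in> E} + sum v {a \<in> parcs F. fst a \<notin> E}" for E
    using assms by (simp add: weight_def exchange_def) (subst sum.union_disjoint, auto)
  then show ?thesis
    using split[OF assms(1)] split[OF assms(2)] by (simp add: weight_def)
qed

section \<open>Minimal forests under the gap condition\<close>

locale minimal_forests =
  fixes V :: "'a pair_pre_digraph" and v :: "'a \<times> 'a \<Rightarrow> real" and k :: nat
  assumes fin: "pair_fin_digraph V"
    and gap: "min_weight V v (k - 1) - min_weight V v k > min_weight V v k - min_weight V v (k + 1)"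
begin

lemma min_forestD:
  assumes "F \<in> min_forests V v k"
  shows "in_forest F" "pverts F = pverts V" "parcs F \<subseteq> parcs V" "card (roots F) = k"
  using assms by (auto simp: min_forests_def in_spanning_forests_iff[OF fin])

text \<open>Both exchanges along a tree of \<open>F\<close> are forests because no arc of \<open>F\<close> enters or leaves it.\<close>

lemma exchange_basin:
  assumes F: "F \<in> min_forests V v k" and G: "G \<in> min_forests V v k" and r: "r \<in> roots F"
  defines "D \<equiv> basin F r"
  shows "exchange D G F \<in> spanning_forests V (card (roots G \<inter> D) + k - 1)"
    and "exchange (- D) G F \<in> spanning_forests V (k + 1 - card (roots G \<inter> D))"
proof -
  interpret F: in_forest F using min_forestD(1)[OF F] .
  interpret G: in_forest G using min_forestD(1)[OF G] .
  have eq: "pverts F = pverts G" using F G by (simp add: min_forestD)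
  have "in_forest (exchange E G F)" if "E = D \<or> E = - D" for E
    using that F.basin_arc_iff[OF r] unfolding D_def
    by (intro in_forest_exchange F.in_forest_axioms G.in_forest_axioms eq) blast
  moreover have "pverts (exchange E G F) = pverts V \<and> parcs (exchange E G F) \<subseteq> parcs V" for E
    using min_forestD[OF F] min_forestD[OF G] by (auto simp: exchange_def)
  moreover have "card (roots (exchange D G F)) = card (roots G \<inter> D) + k - 1"
  proof -
    have "roots F - D = roots F - {r}" using F.roots_Int_basin[OF r] by (auto simp: D_def)
    then have "card (roots F - D) = k - 1"
      using r min_forestD(4)[OF F] by (simp add: card_Diff_singleton)
    moreover have "k \<noteq> 0"
      using r F.finite_roots min_forestD(4)[OF F] card_gt_0_iff by blast
    moreover have "card (roots (exchange D G F)) = card (roots G \<inter> D) + card (roots F - D)"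
      unfolding roots_exchange[OF eq]
      by (rule card_Un_disjoint) (use F.finite_roots G.finite_roots in auto)
    ultimately show ?thesis by simp
  qed
  moreover have "card (roots (exchange (- D) G F)) = k + 1 - card (roots G \<inter> D)"
  proof -
    have "roots (exchange (- D) G F) = (roots G - D) \<union> {r}"
      using F.roots_Int_basin[OF r] by (auto simp: roots_exchange[OF eq] D_def)
    moreover have "card (roots G - D) = k - card (roots G \<inter> D)"
      using G.finite_roots min_forestD(4)[OF G] by (simp add: card_Diff_subset_Int)
    moreover have "r \<notin> roots G - D" using F.root_in_basin[OF r] by (simp add: D_def)
    \<comment> \<open>Subtraction is truncated; this bound makes \<open>k - m + 1\<close> equal to
      \<open>k + 1 - m\<close> for the number \<open>m\<close> of roots of \<open>G\<close> in
      \<open>D\<close>.\<close>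
    moreover have "card (roots G \<inter> D) \<le> k"
      using G.finite_roots min_forestD(4)[OF G] by (metis card_mono inf_le1)
    ultimately show ?thesis using G.finite_roots by simp
  qed
  ultimately show "exchange D G F \<in> spanning_forests V (card (roots G \<inter> D) + k - 1)"
    and "exchange (- D) G F \<in> spanning_forests V (k + 1 - card (roots G \<inter> D))"
    by (simp_all add: in_spanning_forests_iff[OF fin])
qed

lemma weight_exchange_min:
  assumes F: "F \<in> min_forests V v k" and G: "G \<in> min_forests V v k"
  shows "weight v (exchange D G F) + weight v (exchange (- D) G F) = 2 * weight v F"
proof -
  interpret F: in_forest F using min_forestD(1)[OF F] .
  interpret G: in_forest G using min_forestD(1)[OF G] .
  have "weight v F = weight v G" using min_weight_eq[OF F] min_weight_eq[OF G] by simp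
  then show ?thesis using weight_exchange[OF F.pair_finite_arcs G.pair_finite_arcs] by simp
qed

text \<open>Without a root of \<open>G\<close> in the basin, the two exchanges would have
  \<open>k - 1\<close> and \<open>k + 1\<close> trees and together weigh twice the minimum for
  \<open>k\<close>, whereas by \<open>gap\<close> the minima for \<open>k - 1\<close> and
  \<open>k + 1\<close> add up to more.\<close>

lemma basin_has_root:
  assumes F: "F \<in> min_forests V v k" and G: "G \<in> min_forests V v k" and r: "r \<in> roots F"
  shows "roots G \<inter> basin F r \<noteq> {}"
proof
  assume empty: "roots G \<inter> basin F r = {}"
  let ?A = "exchange (basin F r) G F" and ?B = "exchange (- basin F r) G F"
  have "min_weight V v (k - 1) \<le> ereal (weight v ?A)"
    "min_weight V v (k + 1) \<le> ereal (weight v ?B)"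
    using exchange_basin[OF F G r] by (auto simp: empty intro: min_weight_le[OF fin])
  moreover have "min_weight V v k = ereal (weight v F)" using min_weight_eq[OF F] .
  moreover have "weight v ?A + weight v ?B = 2 * weight v F" using weight_exchange_min[OF F G] .
  ultimately show False
    \<comment> \<open>The real weights bound both minima from above, which excludes \<infinity>; the
      value -\<infinity> would contradict \<open>gap\<close>.\<close>
    using gap by (cases "min_weight V v (k - 1)"; cases "min_weight V v (k + 1)") auto
qed

text \<open>The \<open>k\<close> roots of \<open>G\<close> are spread over the \<open>k\<close>
  basins of \<open>F\<close>, each receiving at least one, so none receives two.\<close>

lemma card_roots_Int_basin:
  assumes F: "F \<in> min_forests V v k" and G: "G \<in> min_forests V v k" and r: "r \<in> roots F"
  shows "card (roots G \<inter> basin F r) = 1"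
proof -
  interpret F: in_forest F using min_forestD(1)[OF F] .
  interpret G: in_forest G using min_forestD(1)[OF G] .
  have ge: "1 \<le> card (roots G \<inter> basin F s)" if "s \<in> roots F" for s
    using basin_has_root[OF F G that] G.finite_roots by (simp add: Suc_le_eq card_gt_0_iff)
  have "roots G = (\<Union>s\<in>roots F. roots G \<inter> basin F s)"
  proof -
    have "x \<in> pverts F" if "x \<in> roots G" for x
      using that min_forestD(2)[OF F] min_forestD(2)[OF G] by (simp add: roots_def)
    then show ?thesis using F.basin_exists by blast
  qed
  then have "card (roots G) = card (\<Union>s\<in>roots F. roots G \<inter> basin F s)" by simp
  also have "\<dots> = (\<Sum>s\<in>roots F. card (roots G \<inter> basin F s))"
    using F.finite_roots G.finite_roots F.basin_disjoint by (intro card_UN_disjoint) blast+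
  finally have "(\<Sum>s\<in>roots F. card (roots G \<inter> basin F s)) = (\<Sum>s\<in>roots F. 1)"
    using min_forestD(4)[OF F] min_forestD(4)[OF G] by simp
  then show ?thesis
    using sum_mono_inv[of "\<lambda>_. 1" "roots F" "\<lambda>s. card (roots G \<inter> basin F s)"] ge r F.finite_roots
    by simp
qed

text \<open>With one root of \<open>G\<close> in the basin, both exchanges have \<open>k\<close>
  trees. Neither weighs less than \<open>F\<close>, and together they weigh twice as much, so both
  attain the minimum.\<close>

lemma exchange_basin_min:
  assumes F: "F \<in> min_forests V v k" and G: "G \<in> min_forests V v k" and r: "r \<in> roots F"
  shows "exchange (basin F r) G F \<in> min_forests V v k"
proof -
  let ?A = "exchange (basin F r) G F" and ?B = "exchange (- basin F r) G F"
  have A: "?A \<in> spanning_forests V k" and B: "?B \<in> spanning_forests V k"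
    using exchange_basin[OF F G r] by (auto simp: card_roots_Int_basin[OF F G r])
  have "weight v F \<le> weight v ?A" "weight v F \<le> weight v ?B"
    using min_weight_le[OF fin A, of v] min_weight_le[OF fin B, of v] by (simp_all add: min_weight_eq[OF F])
  then have "weight v ?A = weight v F" using weight_exchange_min[OF F G, of "basin F r"] by simp
  then show ?thesis using A F by (simp add: min_forests_def)
qed

text \<open>Moving the root of the tree of \<open>F\<close> from \<open>r\<close> to \<open>g\<close> gives a minimal forest, which
  again has exactly one root in each tree of \<open>H\<close>.\<close>

lemma roots_not_separated:
  assumes F: "F \<in> min_forests V v k" and G: "G \<in> min_forests V v k" and H: "H \<in> min_forests V v k"
    and r: "r \<in> roots F" and g: "g \<in> roots G" "g \<in> basin F r"
    and s: "s \<in> roots H"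
  shows "r \<in> basin H s \<longleftrightarrow> g \<in> basin H s"
proof -
  have *: "g \<in> basin H s" if s: "s \<in> roots H" and rs: "r \<in> basin H s" for s
  proof -
    interpret F: in_forest F using min_forestD(1)[OF F] .
    have eq: "pverts F = pverts G" using F G by (simp add: min_forestD)
    have "roots G \<inter> basin F r = {g}"
      using card_roots_Int_basin[OF F G r] g by (metis IntI card_1_singletonE singletonD)
    then have "roots (exchange (basin F r) G F) = insert g (roots F - {r})"
      using F.roots_Int_basin[OF r] by (auto simp: roots_exchange[OF eq])
    moreover have "roots F \<inter> basin H s = {r}"
      using card_roots_Int_basin[OF H F s] r rs by (metis IntI card_1_singletonE singletonD)
    moreover have "roots (exchange (basin F r) G F) \<inter> basin H s \<noteq> {}"
      using basin_has_root[OF H exchange_basin_min[OF F G r] s] .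
    \<comment> \<open>Of the roots of \<open>F\<close> only \<open>r\<close> lies in the basin of
      \<open>s\<close>, so after the replacement only \<open>g\<close> can be the required root
      there.\<close>
    ultimately show ?thesis by auto
  qed
  interpret H: in_forest H using min_forestD(1)[OF H] .
  have "r \<in> pverts H" using r min_forestD(2)[OF F] min_forestD(2)[OF H] by (simp add: roots_def)
  then obtain t where t: "t \<in> roots H" "r \<in> basin H t" by (rule H.basin_exists)
  \<comment> \<open>For the converse, \<open>t\<close> is the root of the tree of \<open>H\<close>
    containing \<open>r\<close>, so \<open>g\<close> lies in that tree too; if \<open>g\<close> is
    in the basin of \<open>s\<close>, disjointness gives \<open>s = t\<close>.\<close>
  show ?thesis using *[OF s] *[OF t] H.basin_disjoint[OF s t(1)] t(2) by blast
qed

end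

subsection \<open>Elementary sets of a finite algebra\<close>

lemma algebra_generated_algebra:
  assumes "S \<subseteq> Pow \<Omega>"
  shows "algebra \<Omega> (generated_algebra \<Omega> S)"
proof -
  have "generated_algebra \<Omega> S \<subseteq> Pow \<Omega>"
    using assms algebra_Pow[of \<Omega>] unfolding generated_algebra_def by blast
  then show ?thesis
    unfolding algebra_iff_Un by (auto simp: generated_algebra_def algebra_iff_Un)
qed

lemma generated_algebra_superset: "S \<subseteq> generated_algebra \<Omega> S"
  by (auto simp: generated_algebra_def)

text \<open>The subsets of \<Omega> that do not separate \<open>x\<close> from \<open>y\<close> form
  an algebra containing \<open>S\<close>, hence one containing the generated algebra.\<close>

lemma generated_algebra_not_separated:
  assumes "S \<subseteq> Pow \<Omega>" "x \<in> \<Omega>" "y \<in> \<Omega>" "\<And>A. A \<in> S \<Longrightarrow> x \<in> A \<longleftrightarrow> y \<in> A"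
    and "B \<in> generated_algebra \<Omega> S"
  shows "x \<in> B \<longleftrightarrow> y \<in> B"
proof -
  have "algebra \<Omega> {A \<in> Pow \<Omega>. x \<in> A \<longleftrightarrow> y \<in> A}"
    using assms(2,3) by (auto simp: algebra_iff_Un)
  then show ?thesis using assms(1,4,5) unfolding generated_algebra_def by blast
qed

text \<open>In a finite algebra the intersection of all members containing a given point is itself a
  member; these atoms are the minimal nonempty members.\<close>

lemma elementary_sets_eq:
  assumes "algebra \<Omega> M" "finite \<Omega>"
  shows "elementary_sets M = (\<lambda>x. \<Inter>{B \<in> M. x \<in> B}) ` \<Omega>"
proof -
  interpret algebra \<Omega> M by fact
  let ?atom = "\<lambda>x. \<Inter>{B \<in> M. x \<in> B}"
  have fin: "finite M" using assms(2) space_closed by (meson finite_Pow_iff finite_subset)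
  have atom_in: "?atom x \<in> M" if "x \<in> \<Omega>" for x
  proof -
    have "\<Inter>((\<lambda>B. B) ` {B \<in> M. x \<in> B}) \<in> M"
      using fin top that by (intro finite_INT) auto
    then show ?thesis by simp
  qed
  have minimal: "B = ?atom x" if "x \<in> \<Omega>" "B \<in> M" "B \<noteq> {}" "B \<subseteq> ?atom x" for x B
  proof -
    have "x \<in> B"
    proof (rule ccontr)
      assume "x \<notin> B"
      \<comment> \<open>The complement of \<open>B\<close> would be a member containing
        \<open>x\<close>, so the atom would miss \<open>B\<close>.\<close>
      then have "?atom x \<subseteq> \<Omega> - B" using that by blast
      then show False using that by blast
    qed
    then show ?thesis using that by blast
  qed
  show ?thesis
  proof (intro equalityI subsetI)
    fix A assume A: "A \<in> elementary_sets M"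
    then obtain x where x: "x \<in> A" "A \<in> M" by (auto simp: elementary_sets_def)
    then have "x \<in> \<Omega>" using sets_into_space by blast
    moreover have "?atom x \<subseteq> A" "?atom x \<noteq> {}" using x by blast+
    ultimately have "?atom x = A" using A atom_in by (simp add: elementary_sets_def)
    then show "A \<in> ?atom ` \<Omega>" using \<open>x \<in> \<Omega>\<close> by blast
  next
    fix A assume "A \<in> ?atom ` \<Omega>"
    then obtain x where x: "x \<in> \<Omega>" "A = ?atom x" by blast
    moreover have "x \<in> ?atom x" by auto
    ultimately show "A \<in> elementary_sets M"
      using atom_in[OF x(1)] minimal[OF x(1)] unfolding elementary_sets_def by blast
  qed
qed

text \<open>The atom of \<open>x\<close> lies inside \<open>A\<close>, and minimality of
  \<open>A\<close> makes them equal. So a marked elementary set is determined by any marked vertex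
  in it.\<close>

lemma elementary_set_eq_atom:
  assumes "algebra \<Omega> M" "finite \<Omega>" "A \<in> elementary_sets M" "x \<in> A"
  shows "A = \<Inter>{B \<in> M. x \<in> B}"
proof -
  have A: "A \<in> M" using assms(3) by (simp add: elementary_sets_def)
  interpret algebra \<Omega> M by fact
  have "x \<in> \<Omega>" using A assms(4) sets_into_space by blast
  then have "\<Inter>{B \<in> M. x \<in> B} \<in> elementary_sets M"
    using elementary_sets_eq[OF assms(1,2)] by blast
  moreover have "\<Inter>{B \<in> M. x \<in> B} \<subseteq> A" using A assms(4) by blast
  ultimately show ?thesis using assms(3) unfolding elementary_sets_def by blast
qed

text \<open>For one fixed minimal forest \<open>F\<close>, sending a root to its atom is a bijection
  from the \<open>k\<close> roots of \<open>F\<close> onto the marked elementary sets.\<close>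

lemma (in minimal_forests) card_marked_elementary_sets:
  assumes "spanning_forests V k \<noteq> {}"
  shows "card (marked_elementary_sets V v k) = k"
proof -
  let ?S = "{verts T | T F. F \<in> min_forests V v k \<and> T \<in> trees (with_proj F)}"
  let ?M = "forest_algebra V v k"
  let ?atom = "\<lambda>x. \<Inter>{B \<in> ?M. x \<in> B}"
  interpret V: pair_fin_digraph V by (rule fin)
  obtain F where F: "F \<in> min_forests V v k" using min_forests_nonempty[OF fin assms] by blast
  interpret F: in_forest F using min_forestD(1)[OF F] .
  have S_eq: "?S = (\<Union>H\<in>min_forests V v k. basin H ` roots H)"
  proof -
    have "?S = (\<Union>H\<in>min_forests V v k. verts ` trees (with_proj H))" by auto
    also have "\<dots> = (\<Union>H\<in>min_forests V v k. basin H ` roots H)"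
      by (intro SUP_cong refl) (simp add: in_forest.verts_trees min_forestD(1))
    finally show ?thesis .
  qed
  have S: "?S \<subseteq> Pow (pverts V)"
    unfolding S_eq by (auto simp: basin_def min_forestD(2))
  have alg: "algebra (pverts V) ?M"
    unfolding forest_algebra_def by (rule algebra_generated_algebra[OF S])
  have marked: "marked_vertex V v k j \<longleftrightarrow> (\<exists>G\<in>min_forests V v k. j \<in> roots G)" for j
    unfolding marked_vertex_def
    by (intro bex_cong refl) (simp add: in_forest.is_root_tree_iff min_forestD(1))
  have roots_verts: "roots G \<subseteq> pverts V" if "G \<in> min_forests V v k" for G
    using min_forestD(2)[OF that] by (auto simp: roots_def)
  \<comment> \<open>A marked vertex shares its atom with the root of the tree of \<open>F\<close>
    containing it, since no generator separates the two.\<close>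
  have same: "?atom r = ?atom g"
    if r: "r \<in> roots F" and G: "G \<in> min_forests V v k" and g: "g \<in> roots G" "g \<in> basin F r" for r G g
  proof -
    have "r \<in> B \<longleftrightarrow> g \<in> B" if "B \<in> ?M" for B
    proof (rule generated_algebra_not_separated[OF S])
      show "r \<in> pverts V" "g \<in> pverts V" using roots_verts[OF F] roots_verts[OF G] r g by blast+
      show "B \<in> generated_algebra (pverts V) ?S" using that by (simp only: forest_algebra_def)
      fix A assume "A \<in> ?S"
      then obtain H s where "H \<in> min_forests V v k" "s \<in> roots H" "A = basin H s"
        unfolding S_eq by blast
      then show "r \<in> A \<longleftrightarrow> g \<in> A" using roots_not_separated[OF F G _ r g] by simp
    qed
    then have "{B \<in> ?M. r \<in> B} = {B \<in> ?M. g \<in> B}" by blast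
    then show ?thesis by simp
  qed
  have "marked_elementary_sets V v k = ?atom ` roots F"
  proof (intro equalityI subsetI)
    fix A assume "A \<in> marked_elementary_sets V v k"
    then obtain G g where A: "A \<in> elementary_sets ?M" "g \<in> A"
      and G: "G \<in> min_forests V v k" "g \<in> roots G"
      by (auto simp: marked_elementary_sets_def marked)
    have "g \<in> pverts F" using roots_verts[OF G(1)] G(2) min_forestD(2)[OF F] by auto
    then obtain r where r: "r \<in> roots F" "g \<in> basin F r" by (rule F.basin_exists)
    have "A = ?atom g" by (rule elementary_set_eq_atom[OF alg V.pair_finite_verts A])
    also have "\<dots> = ?atom r" using same[OF r(1) G r(2)] by simp
    finally show "A \<in> ?atom ` roots F" using r by blast
  next
    fix A assume "A \<in> ?atom ` roots F"
    then obtain r where r: "r \<in> roots F" "A = ?atom r" by blast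
    then have "A \<in> elementary_sets ?M"
      using elementary_sets_eq[OF alg V.pair_finite_verts] roots_verts[OF F] by blast
    moreover have "r \<in> A" using r by simp
    ultimately show "A \<in> marked_elementary_sets V v k"
      using r F by (auto simp: marked_elementary_sets_def marked)
  qed
  \<comment> \<open>The vertex sets of the trees of \<open>F\<close> belong to the algebra and
    separate the roots of \<open>F\<close> from each other.\<close>
  moreover have "inj_on ?atom (roots F)"
  proof (rule inj_onI)
    fix r s assume rs: "r \<in> roots F" "s \<in> roots F" and eq: "?atom r = ?atom s"
    have "basin F r \<in> ?M"
      using generated_algebra_superset[of ?S "pverts V"] F rs unfolding forest_algebra_def S_eq by blast
    then have "?atom r \<subseteq> basin F r" using F.root_in_basin[OF rs(1)] by blast
    moreover have "s \<in> ?atom s" by simp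
    ultimately have "s \<in> basin F r" using eq by blast
    then show "r = s" using F.basin_disjoint rs F.root_in_basin by blast
  qed
  ultimately show ?thesis using min_forestD(4)[OF F] by (simp add: card_image)
qed

theorem theorem4:
  fixes N k :: nat and V :: "nat pair_pre_digraph" and v :: "nat \<times> nat \<Rightarrow> real"
  assumes "pair_wf_digraph V" and "pverts V = {1..N}"
    and "2 \<le> k" and "k \<le> N - 1"
    and "spanning_forests V k \<noteq> {}"
    and "min_weight V v (k - 1) - min_weight V v k > min_weight V v k - min_weight V v (k + 1)"
  shows "card (marked_elementary_sets V v k) = k"
proof -
  interpret V: pair_wf_digraph V by fact
  have "parcs V \<subseteq> pverts V \<times> pverts V" by (auto dest: V.wellformed')
  then have "finite (parcs V)"
    using assms(2) by (auto intro: finite_subset)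
  then have "pair_fin_digraph V"
    using assms(2) by unfold_locales auto
  then interpret minimal_forests V v k
    using assms(6) by (rule minimal_forests.intro)
  show ?thesis by (rule card_marked_elementary_sets[OF assms(5)])
qed

end
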